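(* Let $\mathbb K$ be a field and let $A,A^*$ be a Leonard pair over $\mathbb K$. Then the following (i), (ii) are equivalent. (i) $A,A^*$ is in $TD$-$D$ canonical form. (ii) There exists a Leonard system $\Phi$ which is associated with $A,A^*$ and which is in $TD$-$D$ canonical form. Suppose (i), (ii) hold. Then $\Phi$ is the designated Leonard system of $A,A^*$.
   Context: $\mathrm{Mat}_{d+1}(\mathbb K)$ is the algebra of $(d+1)\times(d+1)$ matrices over $\mathbb K$, rows and columns indexed by $0,1,\dots,d$. A matrix is tridiagonal if every nonzero entry lies on the diagonal, subdiagonal or superdiagonal. Leonard pairs and systems. Let $\mathcal A$ be a $\mathbb K$-algebra isomorphic to $\mathrm{Mat}_{d+1}(\mathbb K)$, $d\ge0$. An element $A\in\mathcal A$ is multiplicity-free if it has $d+1$ distinct eigenvalues in $\mathbb K$; if these are $\theta_0,\dots,\theta_d$, the primitive idempotent of $A$ associated with $\theta_i$ is $E_i=\prod_{j\ne i}(A-\theta_jI)/(\theta_i-\theta_j)$. For multiplicity-free $A,A^*\in\mathcal A$ ($A^*$ is just a name, not an adjoint), an idempotent sequence for $A,A^*$ is an ordering $E_0,\dots,E_d$ of the primitive idempotents of $A$ such that $E_iA^*E_j=0$ if $|i-j|>1$ and $E_iA^*E_j\ne0$ if $|i-j|=1$ ($0\le i,j\le d$); a dual idempotent sequence for $A,A^*$ is an idempotent sequence for $A^*,A$. A Leonard pair in $\mathcal A$ (with ambient algebra $\mathcal A$, over $\mathbb K$) is an ordered pair $A,A^*$ of multiplicity-free elements of $\mathcal A$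 for which an idempotent sequence and a dual idempotent sequence exist. A Leonard system in $\mathcal A$ (ambient algebra $\mathcal A$) is a sequence $\Phi=(A,A^*;E_i,E^*_i,i=0..d)$ where $A,A^*\in\mathcal A$ are multiplicity-free, $E_0,\dots,E_d$ is an idempotent sequence for $A,A^*$ and $E^*_0,\dots,E^*_d$ is a dual idempotent sequence for $A,A^*$; then $A,A^*$ is a Leonard pair, said to be associated with $\Phi$ (and $\Phi$ with it). The eigenvalue sequence (resp. dual eigenvalue sequence) of $\Phi$ is $\theta_0,\dots,\theta_d$ (resp. $\theta^*_0,\dots,\theta^*_d$), where $\theta_i$ (resp. $\theta^*_i$) is the eigenvalue of $A$ (resp. $A^*$) associated with $E_i$ (resp. $E^*_i$). An eigenvalue sequence (resp. dual eigenvalue sequence) of a Leonard pair is the eigenvalue (resp. dual eigenvalue) sequence of an associated Leonard system; if $\theta_0,\dots,\theta_d$ is an eigenvalue sequence, then the only other one is $\theta_d,\dots,\theta_0$. $TD$-$D$ canonical form for systems. A Leonard system with eigenvalue sequence $\theta_0,\dots,\theta_d$ and dual eigenvalue sequence $\theta^*_0,\dots,\theta^*_d$ is in $TD$-$D$ canonical form if its ambient algebra is $\mathrm{Mat}_{d+1}(\mathbb K)$, $A$ is tridiagonal and $A^*$ is diagonal, every row sum of $A$ equals $\theta_0$, and $A^*_{00}=\theta^*_0$. $TD$-$D$ canonical form for pairs. A Leonard pair $A,A^*$ with eigenvalue sequence $\theta_0,\dots,\theta_d$ is in $TD$-$D$ canonical form if its ambient algebra is $\mathrm{Mat}_{d+1}(\mathbb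 K)$, $A$ is tridiagonal and $A^*$ is diagonal, and $A$ has constant row sum (all row sums equal) with this sum equal to $\theta_0$ or $\theta_d$. For such a pair there is a unique eigenvalue sequence $\theta_0,\dots,\theta_d$ with $A$ having constant row sum $\theta_0$, and $A^*_{00},\dots,A^*_{dd}$ is a dual eigenvalue sequence; the designated Leonard system of the pair is the associated Leonard system with this eigenvalue sequence and with dual eigenvalue sequence $A^*_{00},\dots,A^*_{dd}$. *)

theory Defs
  imports "HOL-Algebra.QuotRing" "Jordan_Normal_Form.Char_Poly" "Jordan_Normal_Form.VS_Connect"
begin

section \<open>Full matrix algebras\<close>

text \<open>
  A \<open>\<K>\<close>-algebra is a \<^typ>\<open>('k::field, 'a) module\<close> record. The locale \<^locale>\<open>algebra\<close> of
  HOL-Algebra is not applicable, as it requires a commutative multiplication.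
\<close>

definition K_algebra :: "('k::field, 'a) module \<Rightarrow> bool" where
  "K_algebra M \<longleftrightarrow> ring M \<and> module class_ring M \<and>
     (\<forall>c. \<forall>x\<in>carrier M. \<forall>y\<in>carrier M.
        (c \<odot>\<^bsub>M\<^esub> x) \<otimes>\<^bsub>M\<^esub> y = c \<odot>\<^bsub>M\<^esub> (x \<otimes>\<^bsub>M\<^esub> y) \<and>
        x \<otimes>\<^bsub>M\<^esub> (c \<odot>\<^bsub>M\<^esub> y) = c \<odot>\<^bsub>M\<^esub> (x \<otimes>\<^bsub>M\<^esub> y))"

definition algebra_iso :: "('k::field, 'a) module \<Rightarrow> ('k, 'b) module \<Rightarrow> ('a \<Rightarrow> 'b) set" where
  "algebra_iso M N = {h \<in> ring_iso M N. \<forall>c. \<forall>x\<in>carrier M. h (c \<odot>\<^bsub>M\<^esub> x) = c \<odot>\<^bsub>N\<^esub> h x}"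

abbreviation Mat_algebra :: "nat \<Rightarrow> ('k::field, 'k mat) module" where
  "Mat_algebra n \<equiv> module_mat TYPE('k) n n"

definition full_matrix_algebra :: "('k::field, 'a) module \<Rightarrow> nat \<Rightarrow> bool" where
  "full_matrix_algebra M n \<longleftrightarrow> K_algebra M \<and> algebra_iso M (Mat_algebra n) \<noteq> {}"

section \<open>Eigenvalues and primitive idempotents\<close>

text \<open>
  The eigenvalues of an element of an algebra isomorphic to \<open>Mat\<^sub>n(\<K>)\<close> are those of the matrix
  that represents it; they do not depend on the isomorphism.
\<close>

definition eigenvalues_in :: "('k::field, 'a) module \<Rightarrow> nat \<Rightarrow> 'a \<Rightarrow> 'k set" where
  "eigenvalues_in M n A = {t. \<exists>h \<in> algebra_iso M (Mat_algebra n). eigenvalue (h A) t}"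

definition multiplicity_free :: "('k::field, 'a) module \<Rightarrow> nat \<Rightarrow> 'a \<Rightarrow> bool" where
  "multiplicity_free M d A \<longleftrightarrow> A \<in> carrier M \<and> card (eigenvalues_in M (d + 1) A) = d + 1"

text \<open>
  For an ordering \<open>\<theta>\<^sub>0, \<dots>, \<theta>\<^sub>d\<close> of the eigenvalues, the product of \<open>(A - \<theta>\<^sub>j I) / (\<theta>\<^sub>i - \<theta>\<^sub>j)\<close> over
  \<open>j \<noteq> i\<close>. The factors commute, but \<open>M\<close> need not be commutative, hence the product of a list.
\<close>

definition primitive_idempotent :: "('k::field, 'a) module \<Rightarrow> 'a \<Rightarrow> 'k list \<Rightarrow> nat \<Rightarrow> 'a" where
  "primitive_idempotent M A \<theta> i =
     foldr (\<lambda>j X. (inverse (\<theta> ! i - \<theta> ! j) \<odot>\<^bsub>M\<^esub> (A \<ominus>\<^bsub>M\<^esub> (\<theta> ! j) \<odot>\<^bsub>M\<^esub> \<one>\<^bsub>M\<^esub>)) \<otimes>\<^bsub>M\<^esub> X)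
       (filter (\<lambda>j. j \<noteq> i) [0..<length \<theta>]) \<one>\<^bsub>M\<^esub>"

text \<open>
  Sequences indexed by \<open>0, \<dots>, d\<close> are lists of length \<open>d + 1\<close>, so that equality of sequences does not
  depend on values outside the index range. The next predicate says that \<open>E\<close> is an ordering
  of the primitive idempotents of \<open>A\<close>, with \<open>E\<^sub>i\<close> associated with the eigenvalue \<open>\<theta>\<^sub>i\<close>.
\<close>

definition primitive_idempotents_for ::
    "('k::field, 'a) module \<Rightarrow> nat \<Rightarrow> 'a \<Rightarrow> 'k list \<Rightarrow> 'a list \<Rightarrow> bool" where
  "primitive_idempotents_for M d A \<theta> E \<longleftrightarrow>
     length \<theta> = d + 1 \<and> distinct \<theta> \<and> set \<theta> = eigenvalues_in M (d + 1) A \<and>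
     length E = d + 1 \<and> (\<forall>i\<le>d. E ! i = primitive_idempotent M A \<theta> i)"

section \<open>Leonard pairs and Leonard systems\<close>

definition idempotent_sequence ::
    "('k::field, 'a) module \<Rightarrow> nat \<Rightarrow> 'a \<Rightarrow> 'a \<Rightarrow> 'a list \<Rightarrow> bool" where
  "idempotent_sequence M d A A' E \<longleftrightarrow>
     (\<exists>\<theta>. primitive_idempotents_for M d A \<theta> E) \<and>
     (\<forall>i\<le>d. \<forall>j\<le>d.
        (\<bar>int i - int j\<bar> > 1 \<longrightarrow> E ! i \<otimes>\<^bsub>M\<^esub> A' \<otimes>\<^bsub>M\<^esub> E ! j = \<zero>\<^bsub>M\<^esub>) \<and>
        (\<bar>int i - int j\<bar> = 1 \<longrightarrow> E ! i \<otimes>\<^bsub>M\<^esub> A' \<otimes>\<^bsub>M\<^esub> E ! j \<noteq> \<zero>\<^bsub>M\<^esub>))"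

definition leonard_pair :: "('k::field, 'a) module \<Rightarrow> nat \<Rightarrow> 'a \<Rightarrow> 'a \<Rightarrow> bool" where
  "leonard_pair M d A A' \<longleftrightarrow>
     full_matrix_algebra M (d + 1) \<and> multiplicity_free M d A \<and> multiplicity_free M d A' \<and>
     (\<exists>E. idempotent_sequence M d A A' E) \<and> (\<exists>E'. idempotent_sequence M d A' A E')"

text \<open>The components are \<open>A\<close>, \<open>A\<^sup>*\<close>, \<open>E\<^sub>0, \<dots>, E\<^sub>d\<close> and \<open>E\<^sup>*\<^sub>0, \<dots>, E\<^sup>*\<^sub>d\<close>.\<close>

datatype 'a lsys = LSys (ls_A: 'a) (ls_A': 'a) (ls_E: "'a list") (ls_E': "'a list")

definition leonard_system :: "('k::field, 'a) module \<Rightarrow> nat \<Rightarrow> 'a lsys \<Rightarrow> bool" where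
  "leonard_system M d \<Phi> \<longleftrightarrow>
     full_matrix_algebra M (d + 1) \<and>
     multiplicity_free M d (ls_A \<Phi>) \<and> multiplicity_free M d (ls_A' \<Phi>) \<and>
     idempotent_sequence M d (ls_A \<Phi>) (ls_A' \<Phi>) (ls_E \<Phi>) \<and>
     idempotent_sequence M d (ls_A' \<Phi>) (ls_A \<Phi>) (ls_E' \<Phi>)"

definition associated_system ::
    "('k::field, 'a) module \<Rightarrow> nat \<Rightarrow> 'a \<Rightarrow> 'a \<Rightarrow> 'a lsys \<Rightarrow> bool" where
  "associated_system M d A A' \<Phi> \<longleftrightarrow> leonard_system M d \<Phi> \<and> ls_A \<Phi> = A \<and> ls_A' \<Phi> = A'"

definition system_eigenvalue_seq ::
    "('k::field, 'a) module \<Rightarrow> nat \<Rightarrow> 'a lsys \<Rightarrow> 'k list \<Rightarrow> bool" where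
  "system_eigenvalue_seq M d \<Phi> \<theta> \<longleftrightarrow> primitive_idempotents_for M d (ls_A \<Phi>) \<theta> (ls_E \<Phi>)"

definition system_dual_eigenvalue_seq ::
    "('k::field, 'a) module \<Rightarrow> nat \<Rightarrow> 'a lsys \<Rightarrow> 'k list \<Rightarrow> bool" where
  "system_dual_eigenvalue_seq M d \<Phi> \<theta>' \<longleftrightarrow> primitive_idempotents_for M d (ls_A' \<Phi>) \<theta>' (ls_E' \<Phi>)"

definition pair_eigenvalue_seq ::
    "('k::field, 'a) module \<Rightarrow> nat \<Rightarrow> 'a \<Rightarrow> 'a \<Rightarrow> 'k list \<Rightarrow> bool" where
  "pair_eigenvalue_seq M d A A' \<theta> \<longleftrightarrow>
     (\<exists>\<Phi>. associated_system M d A A' \<Phi> \<and> system_eigenvalue_seq M d \<Phi> \<theta>)"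

section \<open>The \<open>TD\<close>-\<open>D\<close> canonical form\<close>

definition tridiagonal_mat :: "'k::zero mat \<Rightarrow> bool" where
  "tridiagonal_mat A \<longleftrightarrow>
     (\<forall>i<dim_row A. \<forall>j<dim_col A. A $$ (i, j) \<noteq> 0 \<longrightarrow> i = j \<or> i = j + 1 \<or> j = i + 1)"

definition constant_row_sum :: "'k::comm_monoid_add mat \<Rightarrow> 'k \<Rightarrow> bool" where
  "constant_row_sum A s \<longleftrightarrow> (\<forall>i<dim_row A. (\<Sum>j<dim_col A. A $$ (i, j)) = s)"

text \<open>
  \<open>M = Mat_algebra (d + 1)\<close> expresses that the ambient algebra is \<open>Mat\<^sub>d\<^sub>+\<^sub>1(\<K>)\<close> itself and not just
  an algebra isomorphic to it.
\<close>

definition system_TD_D :: "('k::field, 'k mat) module \<Rightarrow> nat \<Rightarrow> 'k mat lsys \<Rightarrow> bool" where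
  "system_TD_D M d \<Phi> \<longleftrightarrow>
     leonard_system M d \<Phi> \<and>
     (\<exists>\<theta> \<theta>'. system_eigenvalue_seq M d \<Phi> \<theta> \<and> system_dual_eigenvalue_seq M d \<Phi> \<theta>' \<and>
        M = Mat_algebra (d + 1) \<and>
        tridiagonal_mat (ls_A \<Phi>) \<and> diagonal_mat (ls_A' \<Phi>) \<and>
        constant_row_sum (ls_A \<Phi>) (\<theta> ! 0) \<and> ls_A' \<Phi> $$ (0, 0) = \<theta>' ! 0)"

definition pair_TD_D :: "('k::field, 'k mat) module \<Rightarrow> nat \<Rightarrow> 'k mat \<Rightarrow> 'k mat \<Rightarrow> bool" where
  "pair_TD_D M d A A' \<longleftrightarrow>
     leonard_pair M d A A' \<and>
     (\<exists>\<theta>. pair_eigenvalue_seq M d A A' \<theta> \<and>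
        M = Mat_algebra (d + 1) \<and>
        tridiagonal_mat A \<and> diagonal_mat A' \<and>
        (constant_row_sum A (\<theta> ! 0) \<or> constant_row_sum A (\<theta> ! d)))"

text \<open>Only meaningful for a Leonard pair in \<open>TD\<close>-\<open>D\<close> canonical form.\<close>

definition designated_system ::
    "('k::field, 'k mat) module \<Rightarrow> nat \<Rightarrow> 'k mat \<Rightarrow> 'k mat \<Rightarrow> 'k mat lsys" where
  "designated_system M d A A' =
     (THE \<Phi>. associated_system M d A A' \<Phi> \<and>
        (\<exists>\<theta>. pair_eigenvalue_seq M d A A' \<theta> \<and> constant_row_sum A (\<theta> ! 0) \<and>
           system_eigenvalue_seq M d \<Phi> \<theta>) \<and>
        system_dual_eigenvalue_seq M d \<Phi> (map (\<lambda>i. A' $$ (i, i)) [0..<d + 1]))"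

end

theory Submission
  imports Defs
begin

text \<open>
  If \<open>A\<^sup>*\<close> is diagonal and multiplicity-free, its primitive idempotents are the diagonal matrix units,
  and the idempotents with indices \<open>i\<close>, \<open>j\<close> cut out the entry \<open>A\<^sub>i\<^sub>j\<close> of \<open>A\<close>. Two idempotent sequences
  differ by a permutation of \<open>0, \<dots>, d\<close> that maps neighbours to neighbours, and such a permutation
  is the identity once it fixes \<open>0\<close>; so an idempotent sequence is determined by its first eigenvalue.
  For tridiagonal \<open>A\<close> a dual idempotent sequence permutes the matrix units in such a way that
  neighbours go to neighbours; counting the edges of the path, all entries of \<open>A\<close> next to the
  diagonal are nonzero, and the matrix units in their natural order form a dual idempotent sequence.
\<close>

section \<open>Primitive idempotents as products of commuting factors\<close>

lemma Mat_algebra_minus: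
  fixes A B :: "'k::field mat"
  assumes A: "A \<in> carrier_mat n n" and B: "B \<in> carrier_mat n n"
  shows "A \<ominus>\<^bsub>Mat_algebra n\<^esub> B = A - B"
proof -
  interpret abelian_group "Mat_algebra n :: ('k, 'k mat) module" by (rule abelian_group_mat)
  have "\<ominus>\<^bsub>Mat_algebra n\<^esub> B = - B"
    by (rule minus_equality) (use B in \<open>auto simp: module_mat_simps\<close>)
  then show ?thesis
    using A B by (auto simp: a_minus_def module_mat_simps)
qed

text \<open>Factors are indexed by eigenvalues instead of list positions, so that reordering the
  eigenvalues becomes a matter of multisets.\<close>

definition idempotent_factor :: "'k::field mat \<Rightarrow> 'k \<Rightarrow> 'k \<Rightarrow> 'k mat" where
  "idempotent_factor A s t = inverse (s - t) \<cdot>\<^sub>m (A - t \<cdot>\<^sub>m 1\<^sub>m (dim_row A))"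

lemma idempotent_factor_carrier [simp]:
  "A \<in> carrier_mat n n \<Longrightarrow> idempotent_factor A s t \<in> carrier_mat n n"
  by (auto simp: idempotent_factor_def)

lemma idempotent_factor_commute:
  fixes A :: "'k::field mat"
  assumes A: "A \<in> carrier_mat n n"
  shows "idempotent_factor A s t * idempotent_factor A s u =
    idempotent_factor A s u * idempotent_factor A s t"
proof -
  \<comment> \<open>Up to the order of the summands, the expansion is symmetric in \<open>t\<close>
    and \<open>u\<close>; the scalars in front are treated separately.\<close>
  have expand: "(A - t \<cdot>\<^sub>m 1\<^sub>m n) * (A - u \<cdot>\<^sub>m 1\<^sub>m n) =
      (A * A - u \<cdot>\<^sub>m A) - (t \<cdot>\<^sub>m A - (t * u) \<cdot>\<^sub>m 1\<^sub>m n)" for t u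
  proof -
    have "(A - t \<cdot>\<^sub>m 1\<^sub>m n) * (A - u \<cdot>\<^sub>m 1\<^sub>m n) =
        A * (A - u \<cdot>\<^sub>m 1\<^sub>m n) - (t \<cdot>\<^sub>m 1\<^sub>m n) * (A - u \<cdot>\<^sub>m 1\<^sub>m n)"
      using A by (intro minus_mult_distrib_mat[of _ n n _ _ n]) auto
    also have "A * (A - u \<cdot>\<^sub>m 1\<^sub>m n) = A * A - u \<cdot>\<^sub>m A"
      using A by (subst mult_minus_distrib_mat[of _ n n _ n]) (auto simp: mult_smult_distrib[of _ n n _ n])
    also have "(t \<cdot>\<^sub>m 1\<^sub>m n) * (A - u \<cdot>\<^sub>m 1\<^sub>m n) = t \<cdot>\<^sub>m A - (t * u) \<cdot>\<^sub>m 1\<^sub>m n"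
      using A by (subst mult_smult_assoc_mat[of _ n n _ n]) (auto simp: algebra_simps)
    finally show ?thesis .
  qed
  have "(A - t \<cdot>\<^sub>m 1\<^sub>m n) * (A - u \<cdot>\<^sub>m 1\<^sub>m n) = (A - u \<cdot>\<^sub>m 1\<^sub>m n) * (A - t \<cdot>\<^sub>m 1\<^sub>m n)"
    unfolding expand using A by (intro eq_matI) (auto simp: algebra_simps simp del: index_mult_mat(1))
  moreover have "(a \<cdot>\<^sub>m X) * (b \<cdot>\<^sub>m Y) = (a * b) \<cdot>\<^sub>m (X * Y)"
    if "X \<in> carrier_mat n n" "Y \<in> carrier_mat n n" for a b :: 'k and X Y
    using that by (simp add: mult_smult_distrib[of _ n n _ n] mult_smult_assoc_mat[of _ n n _ n] mult.commute)
      (intro eq_matI; simp del: index_mult_mat(1))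
  ultimately show ?thesis
    using A by (simp add: idempotent_factor_def minus_carrier_mat mult.commute)
qed

lemma foldr_mult_mat_carrier:
  assumes "\<And>x. x \<in> set xs \<Longrightarrow> f x \<in> carrier_mat n n"
  shows "foldr (\<lambda>x X. f x * X) xs (1\<^sub>m n) \<in> carrier_mat n n"
  using assms by (induction xs) (auto intro!: mult_carrier_mat[of _ n n])

lemma foldr_mult_mat_mset:
  fixes f :: "'a \<Rightarrow> 'k::field mat"
  assumes carrier: "\<And>x. f x \<in> carrier_mat n n"
    and comm: "\<And>x y. f x * f y = f y * f x"
    and mset: "mset xs = mset ys"
  shows "foldr (\<lambda>x X. f x * X) xs (1\<^sub>m n) = foldr (\<lambda>x X. f x * X) ys (1\<^sub>m n)"
proof -
  \<comment> \<open>Outside the carrier, products need not be associative; \<open>g\<close> makes the factors commute as functions.\<close>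
  define g where "g x X = (if X \<in> carrier_mat n n then f x * X else X)" for x X
  have "foldr (\<lambda>x X. f x * X) zs (1\<^sub>m n) = foldr g zs (1\<^sub>m n)" for zs
  proof (induction zs)
    case (Cons z zs)
    have "foldr g zs (1\<^sub>m n) \<in> carrier_mat n n"
      using foldr_mult_mat_carrier[of zs f n] carrier unfolding Cons .
    then show ?case
      by (simp add: Cons g_def[of z "foldr g zs (1\<^sub>m n)"])
  qed simp
  moreover have "f x * (f y * X) = f y * (f x * X)" if "X \<in> carrier_mat n n" for x y X
    using assoc_mult_mat[OF carrier carrier that] comm by metis
  then have "g x \<circ> g y = g y \<circ> g x" for x y
    by (intro ext) (simp add: g_def mult_carrier_mat[OF carrier])
  then have "fold g (rev xs) = fold g (rev ys)"
    using mset by (intro fold_multiset_equiv) auto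
  ultimately show ?thesis
    by (simp add: foldr_conv_fold)
qed

text \<open>Deleting the entry at \<open>i\<close> from the eigenvalue list takes the place of
  filtering \<open>i\<close> out of the index list, which is the shape required by
  \<open>foldr_mult_mat_mset\<close>.\<close>

lemma primitive_idempotent_Mat_algebra:
  fixes A :: "'k::field mat"
  assumes A: "A \<in> carrier_mat n n" and i: "i < length \<theta>"
  shows "primitive_idempotent (Mat_algebra n) A \<theta> i =
    foldr (\<lambda>t X. idempotent_factor A (\<theta> ! i) t * X) (take i \<theta> @ drop (Suc i) \<theta>) (1\<^sub>m n)"
proof -
  have *: "inverse c \<odot>\<^bsub>Mat_algebra n\<^esub> (A \<ominus>\<^bsub>Mat_algebra n\<^esub> t \<odot>\<^bsub>Mat_algebra n\<^esub> \<one>\<^bsub>Mat_algebra n\<^esub>) =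
      inverse c \<cdot>\<^sub>m (A - t \<cdot>\<^sub>m 1\<^sub>m n)" for c t
    using A by (auto simp: module_mat_simps Mat_algebra_minus)
  have "[0..<length \<theta>] = [0..<i] @ i # [Suc i..<length \<theta>]"
    using i upt_add_eq_append[of 0 i "length \<theta> - i"] upt_conv_Cons[of i "length \<theta>"] by simp
  then have "filter (\<lambda>j. j \<noteq> i) [0..<length \<theta>] = [0..<i] @ [Suc i..<length \<theta>]"
    by (simp add: filter_id_conv)
  moreover have "map ((!) \<theta>) ([0..<i] @ [Suc i..<length \<theta>]) = take i \<theta> @ drop (Suc i) \<theta>"
    using i by (intro nth_equalityI) (auto simp: nth_append)
  moreover have "primitive_idempotent (Mat_algebra n) A \<theta> i =
      foldr ((\<lambda>t X. idempotent_factor A (\<theta> ! i) t * X) \<circ> (!) \<theta>) (filter (\<lambda>j. j \<noteq> i) [0..<length \<theta>]) (1\<^sub>m n)"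
    using A unfolding primitive_idempotent_def *
    by (simp add: idempotent_factor_def module_mat_simps comp_def)
  ultimately show ?thesis
    by (simp only: foldr_map[symmetric])
qed

text \<open>Removing the shared eigenvalue leaves equal multisets, and the factors commute. Hence a
  primitive idempotent depends on its eigenvalue but not on the place of that eigenvalue in the
  ordering.\<close>

lemma primitive_idempotent_permute:
  fixes A :: "'k::field mat"
  assumes A: "A \<in> carrier_mat n n" and mset: "mset \<theta> = mset \<eta>"
    and i: "i < length \<theta>" and j: "j < length \<eta>" and ij: "\<theta> ! i = \<eta> ! j"
  shows "primitive_idempotent (Mat_algebra n) A \<theta> i = primitive_idempotent (Mat_algebra n) A \<eta> j"
proof -
  have *: "mset (take k \<zeta> @ drop (Suc k) \<zeta>) = mset \<zeta> - {#\<zeta> ! k#}" if "k < length \<zeta>" for k and \<zeta> :: "'k list"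
    by (subst (3) id_take_nth_drop[OF that]) simp
  show ?thesis
    unfolding primitive_idempotent_Mat_algebra[OF A i] primitive_idempotent_Mat_algebra[OF A j] ij
    using A
    by (intro foldr_mult_mat_mset idempotent_factor_commute)
      (auto simp: *[OF i, simplified] *[OF j, simplified] mset ij)
qed

section \<open>Eigenvalues in the matrix algebra and idempotents of diagonal matrices\<close>

lemma eigenvalues_in_Mat_algebra:
  fixes A :: "'k::field mat"
  assumes A: "A \<in> carrier_mat n n"
  shows "eigenvalues_in (Mat_algebra n) n A = {t. eigenvalue A t}"
proof -
  let ?M = "Mat_algebra n :: ('k, 'k mat) module"
  have "id \<in> algebra_iso ?M ?M"
    by (auto simp: algebra_iso_def ring_iso_def ring_hom_def)
  \<comment> \<open>\<open>eigenvalues_in\<close> ranges over all automorphisms \<open>h\<close>,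
    and none of them may add an eigenvalue: if \<open>A - t I\<close> were invertible, so would be
    its image \<open>h A - t I\<close>. The identity gives the other inclusion.\<close>
  moreover have "eigenvalue A t" if h: "h \<in> algebra_iso ?M ?M" and t: "eigenvalue (h A) t" for h t
  proof (rule ccontr)
    assume "\<not> eigenvalue A t"
    let ?C = "char_matrix A t"
    have C: "?C \<in> carrier_mat n n"
      using A by simp
    have "det ?C \<noteq> 0"
      using \<open>\<not> eigenvalue A t\<close> eigenvalue_det[OF A] by simp
    then obtain D where D: "D \<in> carrier_mat n n" "?C * D = 1\<^sub>m n"
      using det_non_zero_imp_unit[OF C, of "()"] by (auto simp: Units_def ring_mat_simps)
    have hom: "h x \<in> carrier_mat n n" "h (x * y) = h x * h y" "h (x + y) = h x + h y"
        "h (1\<^sub>m n) = 1\<^sub>m n" "h (c \<cdot>\<^sub>m x) = c \<cdot>\<^sub>m h x"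
      if "x \<in> carrier_mat n n" "y \<in> carrier_mat n n" for x y c
      using h that ring_hom_memE[of h ?M ?M]
      by (auto simp: algebra_iso_def ring_iso_def module_mat_simps)
    have "h ?C = char_matrix (h A) t"
      using A carrier_matD(1)[OF hom(1)[OF A A]] by (simp add: char_matrix_def hom)
    moreover have "det (char_matrix (h A) t) = 0"
      using t eigenvalue_det[OF hom(1)[OF A A]] by simp
    moreover have "h ?C * h D = 1\<^sub>m n"
      using hom(2)[OF C D(1)] hom(4)[OF A A] D(2) by simp
    then have "det (h ?C) * det (h D) = 1"
      using det_mult[OF hom(1)[OF C C] hom(1)[OF D(1) D(1)]] by simp
    ultimately show False
      by simp
  qed
  ultimately show ?thesis
    unfolding eigenvalues_in_def by (intro Collect_cong iffI bexI[of _ id]) auto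
qed

lemma eigenvalue_diagonal_mat:
  fixes D :: "'k::field mat"
  assumes D: "D \<in> carrier_mat n n" and diag: "diagonal_mat D"
  shows "eigenvalue D t \<longleftrightarrow> t \<in> set (diag_mat D)"
proof -
  have "upper_triangular D"
    using D diag by (auto simp: diagonal_mat_def)
  then have "char_poly D = (\<Prod>a\<leftarrow>diag_mat D. [:- a, 1:])"
    using D by (intro char_poly_upper_triangular)
  then show ?thesis
    by (auto simp: eigenvalue_root_char_poly[OF D] poly_prod_list prod_list_zero_iff)
qed

definition matrix_unit :: "nat \<Rightarrow> nat \<Rightarrow> 'k::zero_neq_one mat" where
  "matrix_unit n i = mat n n (\<lambda>(k, l). if k = i \<and> l = i then 1 else 0)"

lemma mult_diagonal_mat:
  fixes f g :: "nat \<Rightarrow> 'k::semiring_1"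
  shows "mat n n (\<lambda>(k, l). if k = l then f k else 0) * mat n n (\<lambda>(k, l). if k = l then g k else 0) =
    mat n n (\<lambda>(k, l). if k = l then f k * g k else 0)"
  by (intro eq_matI) (auto simp: scalar_prod_def if_distrib[where f = "\<lambda>x. x * c" for c]
        if_distrib[where f = "\<lambda>x. c * x" for c] cong: if_cong)

text \<open>Diagonal matrices multiply entrywise, so each diagonal entry is a polynomial evaluated
  at \<open>D $$ (k, k)\<close>. If \<open>ts\<close> lists the eigenvalues other than
  \<open>s\<close>, it is the Lagrange basis polynomial of the node \<open>s\<close>.\<close>

lemma foldr_idempotent_factor_diagonal:
  fixes D :: "'k::field mat"
  assumes D: "D \<in> carrier_mat n n" and diag: "diagonal_mat D"
  shows "foldr (\<lambda>t X. idempotent_factor D s t * X) ts (1\<^sub>m n) =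
    mat n n (\<lambda>(k, l). if k = l then \<Prod>t\<leftarrow>ts. inverse (s - t) * (D $$ (k, k) - t) else 0)"
proof (induction ts)
  case Nil
  show ?case by (auto simp: one_mat_def)
next
  case (Cons t ts)
  have "idempotent_factor D s t = mat n n (\<lambda>(k, l). if k = l then inverse (s - t) * (D $$ (k, k) - t) else 0)"
    using D diag by (intro eq_matI) (auto simp: idempotent_factor_def diagonal_mat_def)
  then show ?case
    by (simp add: Cons mult_diagonal_mat) (intro cong_mat; simp)
qed

text \<open>The Lagrange basis polynomial of the node \<open>D $$ (i, i)\<close> is 1 at this node
  and 0 at the other diagonal entries. Distinctness keeps the denominators nonzero.\<close>

lemma primitive_idempotent_diagonal:
  fixes D :: "'k::field mat"
  assumes D: "D \<in> carrier_mat n n" and diag: "diagonal_mat D"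
    and distinct: "distinct (diag_mat D)" and i: "i < n"
  shows "primitive_idempotent (Mat_algebra n) D (diag_mat D) i = matrix_unit n i"
proof -
  let ?ts = "take i (diag_mat D) @ drop (Suc i) (diag_mat D)"
  have len: "length (diag_mat D) = n" and nth: "\<And>k. k < n \<Longrightarrow> diag_mat D ! k = D $$ (k, k)"
    using D by (auto simp: diag_mat_def)
  have split: "diag_mat D = take i (diag_mat D) @ D $$ (i, i) # drop (Suc i) (diag_mat D)"
    using id_take_nth_drop[of i "diag_mat D"] i by (simp add: len nth)
  have nin: "D $$ (i, i) \<notin> set ?ts"
    using distinct by (subst (asm) split) auto
  have prod: "(\<Prod>t\<leftarrow>?ts. inverse (D $$ (i, i) - t) * (D $$ (k, k) - t)) = (if k = i then 1 else 0)"
    if k: "k < n" for k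
  proof (cases "k = i")
    case True
    have "map (\<lambda>t. inverse (D $$ (i, i) - t) * (D $$ (i, i) - t)) ?ts = map (\<lambda>_. 1) ?ts"
      using nin by (intro map_cong refl left_inverse) (metis right_minus_eq)
    then show ?thesis
      unfolding True by (simp only: map_replicate_const prod_list_replicate) simp
  next
    case False
    have "D $$ (k, k) \<noteq> D $$ (i, i)"
      using distinct False k i nth_eq_iff_index_eq[OF distinct] by (metis len nth)
    moreover have "D $$ (k, k) \<in> set (diag_mat D)"
      using k len nth nth_mem by metis
    ultimately have "D $$ (k, k) \<in> set ?ts"
      by (subst (asm) split) auto
    then have "0 \<in> set (map (\<lambda>t. inverse (D $$ (i, i) - t) * (D $$ (k, k) - t)) ?ts)"
      unfolding set_map by (rule rev_image_eqI) simp
    then show ?thesis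
      using False by (simp only: prod_list_zero_iff) simp
  qed
  have "primitive_idempotent (Mat_algebra n) D (diag_mat D) i =
      mat n n (\<lambda>(k, l). if k = l then \<Prod>t\<leftarrow>?ts. inverse (D $$ (i, i) - t) * (D $$ (k, k) - t) else 0)"
    using i by (simp only: primitive_idempotent_Mat_algebra[OF D] len nth
        foldr_idempotent_factor_diagonal[OF D diag])
  also have "\<dots> = matrix_unit n i"
    unfolding matrix_unit_def using prod by (intro cong_mat) (simp_all del: map_append)
  finally show ?thesis .
qed

lemma primitive_idempotents_for_diagonal:
  fixes D :: "'k::field mat"
  assumes mf: "multiplicity_free (Mat_algebra (d + 1)) d D" and diag: "diagonal_mat D"
  shows "primitive_idempotents_for (Mat_algebra (d + 1)) d D (diag_mat D) (map (matrix_unit (d + 1)) [0..<d + 1])"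
proof -
  have D: "D \<in> carrier_mat (d + 1) (d + 1)"
    using mf by (simp add: multiplicity_free_def module_mat_simps)
  have set: "set (diag_mat D) = eigenvalues_in (Mat_algebra (d + 1)) (d + 1) D"
    unfolding eigenvalues_in_Mat_algebra[OF D] eigenvalue_diagonal_mat[OF D diag] by simp
  have len: "length (diag_mat D) = d + 1"
    using D by (auto simp: diag_mat_def)
  \<comment> \<open>The diagonal has length \<open>d + 1\<close>, and by multiplicity-freeness its
    set has \<open>d + 1\<close> elements.\<close>
  have distinct: "distinct (diag_mat D)"
    using mf by (intro card_distinct) (simp add: set len multiplicity_free_def)
  have "map (matrix_unit (d + 1)) [0..<d + 1] ! i = primitive_idempotent (Mat_algebra (d + 1)) D (diag_mat D) i"
    if "i \<le> d" for i
    using primitive_idempotent_diagonal[OF D diag distinct, of i] that by (simp del: upt_Suc)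
  then show ?thesis
    unfolding primitive_idempotents_for_def using set len distinct by simp
qed

lemma matrix_unit_mult:
  fixes A :: "'k::field mat"
  assumes A: "A \<in> carrier_mat n n" and i: "i < n" and j: "j < n"
  shows "matrix_unit n i * A * matrix_unit n j =
    mat n n (\<lambda>(k, l). if k = i \<and> l = j then A $$ (i, j) else 0)"
proof -
  have "matrix_unit n i * A = mat n n (\<lambda>(k, l). if k = i then A $$ (i, l) else 0)"
    using A i
    by (intro eq_matI) (auto simp: matrix_unit_def scalar_prod_def if_distrib[where f = "\<lambda>x. x * c" for c] cong: if_cong)
  moreover have "mat n n (\<lambda>(k, l). if k = i then A $$ (i, l) else 0) * matrix_unit n j =
      mat n n (\<lambda>(k, l). if k = i \<and> l = j then A $$ (i, j) else 0)"
    using j by (intro eq_matI) (auto simp: matrix_unit_def scalar_prod_def if_distrib[where f = "\<lambda>x. x * c" for c]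
        if_distrib[where f = "\<lambda>x. c * x" for c] cong: if_cong)
  ultimately show ?thesis
    by simp
qed

text \<open>When the idempotents are matrix units, this turns the vanishing conditions of
  \<open>idempotent_sequence\<close> into conditions on single entries of \<open>A\<close>.\<close>

lemma matrix_unit_mult_eq_0_iff:
  fixes A :: "'k::field mat"
  assumes A: "A \<in> carrier_mat n n" and i: "i < n" and j: "j < n"
  shows "matrix_unit n i * A * matrix_unit n j = 0\<^sub>m n n \<longleftrightarrow> A $$ (i, j) = 0"
proof
  assume *: "matrix_unit n i * A * matrix_unit n j = 0\<^sub>m n n"
  show "A $$ (i, j) = 0"
    using arg_cong[OF *, of "\<lambda>X. X $$ (i, j)"] i j by (simp add: matrix_unit_mult[OF A i j])
next
  assume "A $$ (i, j) = 0"
  then show "matrix_unit n i * A * matrix_unit n j = 0\<^sub>m n n"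
    by (intro eq_matI) (auto simp: matrix_unit_mult[OF A i j])
qed

section \<open>Permutations of 0, ..., d that preserve adjacency\<close>

lemma path_endomorphism_surj:
  fixes \<sigma> :: "nat \<Rightarrow> nat"
  assumes inj: "inj_on \<sigma> {..d}" and img: "\<sigma> ` {..d} \<subseteq> {..d}"
    and adj: "\<And>i j. i \<le> d \<Longrightarrow> j \<le> d \<Longrightarrow> \<bar>int i - int j\<bar> = 1 \<Longrightarrow> \<bar>int (\<sigma> i) - int (\<sigma> j)\<bar> = 1"
    and kl: "k \<le> d" "l \<le> d" "\<bar>int k - int l\<bar> = 1"
  obtains i j where "i \<le> d" "j \<le> d" "\<bar>int i - int j\<bar> = 1" "\<sigma> i = k" "\<sigma> j = l"
proof -
  let ?P = "{(i, j). i \<le> d \<and> j \<le> d \<and> \<bar>int i - int j\<bar> = 1}"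
  have sub: "?P \<subseteq> {..d} \<times> {..d}"
    by auto
  \<comment> \<open>\<open>?P\<close> is the set of directed edges of the path; it is finite, so an
    injective map of it into itself is onto.\<close>
  have "map_prod \<sigma> \<sigma> ` ?P = ?P"
  proof (rule endo_inj_surj)
    show "finite ?P"
      using sub by (rule finite_subset) simp
    show "map_prod \<sigma> \<sigma> ` ?P \<subseteq> ?P"
      using img adj by auto
    show "inj_on (map_prod \<sigma> \<sigma>) ?P"
      using map_prod_inj_on[OF inj inj] sub by (rule inj_on_subset)
  qed
  moreover have "(k, l) \<in> ?P"
    using kl by simp
  ultimately have "(k, l) \<in> map_prod \<sigma> \<sigma> ` ?P"
    by simp
  then show thesis
    using that by (elim imageE) (auto simp del: of_nat_diff)
qed

text \<open>If \<open>m\<close> and \<open>m + 1\<close> are fixed, then \<open>m + 2\<close> goes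
  to a neighbour of \<open>m + 1\<close>, and by injectivity the neighbour \<open>m\<close> is
  already taken.\<close>

lemma path_endomorphism_id:
  fixes \<sigma> :: "nat \<Rightarrow> nat"
  assumes inj: "inj_on \<sigma> {..d}" and zero: "\<sigma> 0 = 0"
    and adj: "\<And>i j. i \<le> d \<Longrightarrow> j \<le> d \<Longrightarrow> \<bar>int i - int j\<bar> = 1 \<Longrightarrow> \<bar>int (\<sigma> i) - int (\<sigma> j)\<bar> = 1"
    and "k \<le> d"
  shows "\<sigma> k = k"
  using \<open>k \<le> d\<close>
proof (induction k rule: less_induct)
  case (less k)
  consider "k = 0" | "k = 1" | m where "k = m + 2"
    by (metis One_nat_def add_2_eq_Suc' not0_implies_Suc)
  then show ?case
  proof cases
    case 1
    then show ?thesis using zero by simp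
  next
    case 2
    then show ?thesis using adj[of 1 0] less.prems zero by simp
  next
    case 3
    have "\<bar>int (\<sigma> (m + 2)) - int (m + 1)\<bar> = 1"
      using adj[of "m + 2" "m + 1"] less.IH[of "m + 1"] less.prems 3 by simp
    moreover have "\<sigma> (m + 2) \<noteq> m"
      using inj_onD[OF inj, of "m + 2" m] less.IH[of m] less.prems 3 by auto
    ultimately have "\<sigma> (m + 2) = m + 2"
      by linarith
    then show ?thesis
      using 3 by simp
  qed
qed

section \<open>Comparison of idempotent sequences\<close>

lemma primitive_idempotents_for_permute:
  fixes A :: "'k::field mat"
  assumes A: "A \<in> carrier_mat (d + 1) (d + 1)"
    and E: "primitive_idempotents_for (Mat_algebra (d + 1)) d A \<theta> E"
    and F: "primitive_idempotents_for (Mat_algebra (d + 1)) d A \<eta> F"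
  obtains \<sigma> where "inj_on \<sigma> {..d}" "\<sigma> ` {..d} \<subseteq> {..d}"
    "\<forall>i\<le>d. \<eta> ! i = \<theta> ! \<sigma> i" "\<forall>i\<le>d. F ! i = E ! \<sigma> i"
proof -
  have len: "length \<theta> = d + 1" "length \<eta> = d + 1"
    and distinct: "distinct \<theta>" "distinct \<eta>" and sets: "set \<eta> = set \<theta>"
    and nth: "\<And>i. i \<le> d \<Longrightarrow> E ! i = primitive_idempotent (Mat_algebra (d + 1)) A \<theta> i"
      "\<And>i. i \<le> d \<Longrightarrow> F ! i = primitive_idempotent (Mat_algebra (d + 1)) A \<eta> i"
    using E F by (auto simp: primitive_idempotents_for_def)
  have "\<exists>k\<le>d. \<eta> ! i = \<theta> ! k" if "i \<le> d" for i
  proof -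
    have "\<eta> ! i \<in> set \<theta>"
      using that len sets by (metis less_Suc_eq_le Suc_eq_plus1 nth_mem)
    then show ?thesis
      using len by (auto simp: in_set_conv_nth less_Suc_eq_le)
  qed
  \<comment> \<open>\<sigma> sends \<open>i\<close> to the position of the eigenvalue
    \<open>\<eta> ! i\<close> in \<theta>; the idempotents follow their eigenvalues.\<close>
  then obtain \<sigma> where \<sigma>: "\<And>i. i \<le> d \<Longrightarrow> \<sigma> i \<le> d" "\<And>i. i \<le> d \<Longrightarrow> \<eta> ! i = \<theta> ! \<sigma> i"
    by metis
  show thesis
  proof
    show "inj_on \<sigma> {..d}"
    proof (rule inj_onI)
      fix i j assume "i \<in> {..d}" "j \<in> {..d}" "\<sigma> i = \<sigma> j"
      then have "\<eta> ! i = \<eta> ! j" "i < length \<eta>" "j < length \<eta>"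
        using \<sigma>(2) len by auto
      then show "i = j"
        using nth_eq_iff_index_eq[OF distinct(2)] by blast
    qed
    show "\<sigma> ` {..d} \<subseteq> {..d}"
      using \<sigma>(1) by auto
    show "\<forall>i\<le>d. \<eta> ! i = \<theta> ! \<sigma> i"
      using \<sigma>(2) by blast
    show "\<forall>i\<le>d. F ! i = E ! \<sigma> i"
    proof (intro allI impI)
      fix i assume "i \<le> d"
      have "mset \<eta> = mset \<theta>"
        using set_eq_iff_mset_eq_distinct[OF distinct(2,1)] sets by blast
      then have "primitive_idempotent (Mat_algebra (d + 1)) A \<eta> i =
          primitive_idempotent (Mat_algebra (d + 1)) A \<theta> (\<sigma> i)"
        using \<open>i \<le> d\<close> \<sigma> len by (intro primitive_idempotent_permute[OF A]) (auto simp: less_Suc_eq_le)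
      then show "F ! i = E ! \<sigma> i"
        using \<open>i \<le> d\<close> nth \<sigma> by simp
    qed
  qed
qed

text \<open>The permutation relating both sequences fixes 0, since the first eigenvalues agree. It
  preserves adjacency, since products for neighbours in \<open>F\<close> are nonzero while products
  for distant indices in \<open>E\<close> vanish. So \<open>path_endomorphism_id\<close>
  applies.\<close>

lemma idempotent_sequence_unique:
  fixes A :: "'k::field mat"
  assumes A: "A \<in> carrier_mat (d + 1) (d + 1)"
    and E: "idempotent_sequence (Mat_algebra (d + 1)) d A B E"
      "primitive_idempotents_for (Mat_algebra (d + 1)) d A \<theta> E"
    and F: "idempotent_sequence (Mat_algebra (d + 1)) d A B F"
      "primitive_idempotents_for (Mat_algebra (d + 1)) d A \<eta> F"
    and zero: "\<theta> ! 0 = \<eta> ! 0"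
  shows "E = F"
proof -
  obtain \<sigma> where inj: "inj_on \<sigma> {..d}" and img: "\<sigma> ` {..d} \<subseteq> {..d}"
    and \<eta>: "\<forall>i\<le>d. \<eta> ! i = \<theta> ! \<sigma> i" and F_nth: "\<forall>i\<le>d. F ! i = E ! \<sigma> i"
    by (rule primitive_idempotents_for_permute[OF A E(2) F(2)])
  have \<theta>: "distinct \<theta>" "length \<theta> = d + 1" and len: "length E = d + 1" "length F = d + 1"
    using E(2) F(2) by (auto simp: primitive_idempotents_for_def)
  have "\<sigma> 0 \<le> d"
    using img by auto
  then have "\<sigma> 0 = 0"
    using nth_eq_iff_index_eq[OF \<theta>(1), of "\<sigma> 0" 0] \<theta>(2) \<eta> zero by simp
  moreover have "\<bar>int (\<sigma> i) - int (\<sigma> j)\<bar> = 1" if ij: "i \<le> d" "j \<le> d" "\<bar>int i - int j\<bar> = 1" for i j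
  proof -
    have "\<sigma> i \<noteq> \<sigma> j"
      using inj_onD[OF inj, of i j] ij by auto
    moreover have "\<not> \<bar>int (\<sigma> i) - int (\<sigma> j)\<bar> > 1"
    proof
      assume "\<bar>int (\<sigma> i) - int (\<sigma> j)\<bar> > 1"
      moreover have "\<sigma> i \<le> d" "\<sigma> j \<le> d"
        using img ij by auto
      ultimately have "F ! i * B * F ! j = 0\<^sub>m (d + 1) (d + 1)"
        using E(1) ij by (simp add: idempotent_sequence_def module_mat_simps F_nth)
      then show False
        using F(1) ij by (simp add: idempotent_sequence_def module_mat_simps)
    qed
    ultimately show ?thesis
      by linarith
  qed
  ultimately have "\<sigma> k = k" if "k \<le> d" for k
    using path_endomorphism_id[OF inj] that by blast
  then show ?thesis
    using len F_nth by (intro nth_equalityI) auto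
qed

lemma primitive_idempotents_for_rev:
  fixes A :: "'k::field mat"
  assumes A: "A \<in> carrier_mat (d + 1) (d + 1)"
    and E: "primitive_idempotents_for (Mat_algebra (d + 1)) d A \<theta> E"
  shows "primitive_idempotents_for (Mat_algebra (d + 1)) d A (rev \<theta>) (rev E)"
proof -
  have "rev E ! i = primitive_idempotent (Mat_algebra (d + 1)) A (rev \<theta>) i" if "i \<le> d" for i
  proof -
    have "primitive_idempotent (Mat_algebra (d + 1)) A \<theta> (d - i) =
        primitive_idempotent (Mat_algebra (d + 1)) A (rev \<theta>) i"
      using E that
      by (intro primitive_idempotent_permute[OF A]) (auto simp: primitive_idempotents_for_def rev_nth)
    then show ?thesis
      using E that by (auto simp: primitive_idempotents_for_def rev_nth)
  qed
  then show ?thesis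
    using E by (auto simp: primitive_idempotents_for_def)
qed

text \<open>The conditions depend only on \<open>\<bar>i - j\<bar>\<close>, which reversal keeps.
  Reversal is needed when the row sum is the last eigenvalue instead of the first.\<close>

lemma idempotent_sequence_rev:
  fixes A :: "'k::field mat"
  assumes A: "A \<in> carrier_mat (d + 1) (d + 1)"
    and E: "idempotent_sequence (Mat_algebra (d + 1)) d A B E"
  shows "idempotent_sequence (Mat_algebra (d + 1)) d A B (rev E)"
proof -
  obtain \<theta> where \<theta>: "primitive_idempotents_for (Mat_algebra (d + 1)) d A \<theta> E"
    using E by (auto simp: idempotent_sequence_def)
  then have nth: "rev E ! i = E ! (d - i)" if "i \<le> d" for i
    using that by (simp add: primitive_idempotents_for_def rev_nth)
  have "\<bar>int i - int j\<bar> = \<bar>int (d - i) - int (d - j)\<bar>" if "i \<le> d" "j \<le> d" for i j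
    using that by linarith
  then show ?thesis
    using E primitive_idempotents_for_rev[OF A \<theta>] by (auto simp: idempotent_sequence_def nth)
qed

text \<open>Tridiagonality alone would allow zeros next to the diagonal; the existence of some dual
  idempotent sequence \<open>E\<close>, in whatever order, excludes them.\<close>

lemma idempotent_sequence_matrix_units:
  fixes A D :: "'k::field mat"
  assumes A: "A \<in> carrier_mat (d + 1) (d + 1)" and tri: "tridiagonal_mat A"
    and mf: "multiplicity_free (Mat_algebra (d + 1)) d D" and diag: "diagonal_mat D"
    and E: "idempotent_sequence (Mat_algebra (d + 1)) d D A E"
  shows "idempotent_sequence (Mat_algebra (d + 1)) d D A (map (matrix_unit (d + 1)) [0..<d + 1])"
    (is "idempotent_sequence ?M d D A ?U")
proof -
  have U: "primitive_idempotents_for ?M d D (diag_mat D) ?U"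
    using primitive_idempotents_for_diagonal[OF mf diag] .
  have D: "D \<in> carrier_mat (d + 1) (d + 1)"
    using mf by (simp add: multiplicity_free_def module_mat_simps)
  obtain \<theta> where \<theta>: "primitive_idempotents_for ?M d D \<theta> E"
    using E by (auto simp: idempotent_sequence_def)
  obtain \<sigma> where inj: "inj_on \<sigma> {..d}" and img: "\<sigma> ` {..d} \<subseteq> {..d}"
    and "\<forall>i\<le>d. \<theta> ! i = diag_mat D ! \<sigma> i" and E_nth: "\<forall>i\<le>d. E ! i = ?U ! \<sigma> i"
    by (rule primitive_idempotents_for_permute[OF D U \<theta>])
  have zero_iff: "?U ! i * A * ?U ! j = 0\<^sub>m (d + 1) (d + 1) \<longleftrightarrow> A $$ (i, j) = 0"
    if "i \<le> d" "j \<le> d" for i j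
    using that matrix_unit_mult_eq_0_iff[OF A, of i j] by (simp del: upt_Suc)
  have far: "A $$ (i, j) = 0" if "i \<le> d" "j \<le> d" "\<bar>int i - int j\<bar> > 1" for i j
  proof -
    have "\<not> (i = j \<or> i = j + 1 \<or> j = i + 1)" "i < dim_row A" "j < dim_col A"
      using that A by auto
    then show ?thesis
      using tri unfolding tridiagonal_mat_def by blast
  qed
  have nonzero: "A $$ (\<sigma> i, \<sigma> j) \<noteq> 0" if ij: "i \<le> d" "j \<le> d" "\<bar>int i - int j\<bar> = 1" for i j
  proof -
    have "E ! i * A * E ! j \<noteq> 0\<^sub>m (d + 1) (d + 1)"
      using E ij by (simp add: idempotent_sequence_def module_mat_simps)
    moreover have "\<sigma> i \<le> d" "\<sigma> j \<le> d"
      using img ij by auto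
    ultimately show ?thesis
      using zero_iff[of "\<sigma> i" "\<sigma> j"] E_nth ij by metis
  qed
  \<comment> \<open>A nonzero entry of a tridiagonal matrix that is off the diagonal lies right next
    to it; injectivity of \<sigma> excludes the diagonal.\<close>
  have adj: "\<bar>int (\<sigma> i) - int (\<sigma> j)\<bar> = 1" if ij: "i \<le> d" "j \<le> d" "\<bar>int i - int j\<bar> = 1" for i j
  proof -
    have "\<sigma> i \<noteq> \<sigma> j" "\<sigma> i \<le> d" "\<sigma> j \<le> d"
      using inj_onD[OF inj, of i j] img ij by auto
    then show ?thesis
      using nonzero[OF ij] far[of "\<sigma> i" "\<sigma> j"] by (cases "\<bar>int (\<sigma> i) - int (\<sigma> j)\<bar> > 1") auto
  qed
  \<comment> \<open>So far only entries at images of edges are known to be nonzero; surjectivity on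
    edges reaches every position next to the diagonal.\<close>
  have "A $$ (k, l) \<noteq> 0" if "k \<le> d" "l \<le> d" "\<bar>int k - int l\<bar> = 1" for k l
  proof (rule path_endomorphism_surj[OF inj img _ that])
    show "A $$ (k, l) \<noteq> 0"
      if "i \<le> d" "j \<le> d" "\<bar>int i - int j\<bar> = 1" "\<sigma> i = k" "\<sigma> j = l" for i j
      using nonzero[OF that(1-3)] that(4,5) by simp
  qed (rule adj)
  then show ?thesis
    using U far zero_iff by (auto simp: idempotent_sequence_def module_mat_simps simp del: upt_Suc)
qed

section \<open>Canonical form and the designated system\<close>

lemma system_TD_D_eq_designated_system:
  fixes A A' :: "'k::field mat" and d :: nat
  defines "M \<equiv> Mat_algebra (d + 1)"
  assumes sys: "associated_system M d A A' \<Phi>" and td: "system_TD_D M d \<Phi>"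
  shows "\<Phi> = designated_system M d A A'"
proof -
  let ?\<delta> = "map (\<lambda>i. A' $$ (i, i)) [0..<d + 1]"
  let ?P = "\<lambda>\<Psi>. associated_system M d A A' \<Psi> \<and>
    (\<exists>\<theta>. pair_eigenvalue_seq M d A A' \<theta> \<and> constant_row_sum A (\<theta> ! 0) \<and>
      system_eigenvalue_seq M d \<Psi> \<theta>) \<and> system_dual_eigenvalue_seq M d \<Psi> ?\<delta>"
  have sys': "ls_A \<Phi> = A" "ls_A' \<Phi> = A'" "multiplicity_free M d A" "multiplicity_free M d A'"
      "idempotent_sequence M d A' A (ls_E' \<Phi>)"
    using sys by (auto simp: associated_system_def leonard_system_def)
  then have A: "A \<in> carrier_mat (d + 1) (d + 1)" "A' \<in> carrier_mat (d + 1) (d + 1)"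
    by (auto simp: multiplicity_free_def M_def module_mat_simps)
  obtain \<theta> \<theta>' where \<theta>: "system_eigenvalue_seq M d \<Phi> \<theta>" "constant_row_sum A (\<theta> ! 0)"
    and \<theta>': "primitive_idempotents_for M d A' \<theta>' (ls_E' \<Phi>)" "A' $$ (0, 0) = \<theta>' ! 0"
    and tri: "tridiagonal_mat A" and diag: "diagonal_mat A'"
    using td sys' by (auto simp: system_TD_D_def system_dual_eigenvalue_seq_def)
  have \<delta>: "diag_mat A' = ?\<delta>"
    using A by (simp add: diag_mat_def)
  have units: "primitive_idempotents_for M d A' ?\<delta> (map (matrix_unit (d + 1)) [0..<d + 1])"
    using primitive_idempotents_for_diagonal[of d A'] sys'(4) diag unfolding \<delta> M_def by blast
  have "idempotent_sequence M d A' A (map (matrix_unit (d + 1)) [0..<d + 1])"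
    using idempotent_sequence_matrix_units[OF A(1) tri _ diag] sys'(4,5) unfolding M_def by blast
  \<comment> \<open>Both dual sequences start with the eigenvalue \<open>A' $$ (0, 0)\<close>, which
    fixes the whole order.\<close>
  then have "ls_E' \<Phi> = map (matrix_unit (d + 1)) [0..<d + 1]"
    using idempotent_sequence_unique[OF A(2)] sys'(5) \<theta>' units unfolding M_def
    by (simp del: upt_Suc)
  then have "system_dual_eigenvalue_seq M d \<Phi> ?\<delta>"
    using units by (simp add: system_dual_eigenvalue_seq_def sys')
  then have P: "?P \<Phi>"
    using sys \<theta> unfolding pair_eigenvalue_seq_def by blast
  \<comment> \<open>Uniqueness makes the definite description in \<open>designated_system\<close>
    meaningful.\<close>
  have "\<Psi> = \<Phi>" if \<Psi>: "?P \<Psi>" for \<Psi>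
  proof (rule lsys.expand)
    obtain \<eta> where \<eta>: "system_eigenvalue_seq M d \<Psi> \<eta>" "constant_row_sum A (\<eta> ! 0)"
      using \<Psi> by blast
    have sys\<Psi>: "ls_A \<Psi> = A" "ls_A' \<Psi> = A'"
      using \<Psi> by (auto simp: associated_system_def)
    \<comment> \<open>Both are the sum of the same row of \<open>A\<close>; there is a row because
      \<open>d + 1\<close> is positive.\<close>
    have "\<eta> ! 0 = \<theta> ! 0"
      using \<eta>(2) \<theta>(2) A(1) unfolding constant_row_sum_def by force
    then have "ls_E \<Psi> = ls_E \<Phi>"
      using idempotent_sequence_unique[OF A(1), of A' "ls_E \<Psi>" \<eta> "ls_E \<Phi>" \<theta>]
        \<Psi> sys \<eta>(1) \<theta>(1) sys\<Psi> sys'(1,2)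
      by (simp add: M_def associated_system_def leonard_system_def system_eigenvalue_seq_def)
    \<comment> \<open>Both dual sequences belong to the same eigenvalue list
      \<open>?\<delta>\<close>, which determines every entry.\<close>
    moreover have "ls_E' \<Psi> = ls_E' \<Phi>"
      using \<Psi> P sys' sys\<Psi>
      by (intro nth_equalityI) (auto simp: system_dual_eigenvalue_seq_def primitive_idempotents_for_def)
    ultimately show "ls_A \<Psi> = ls_A \<Phi> \<and> ls_A' \<Psi> = ls_A' \<Phi> \<and> ls_E \<Psi> = ls_E \<Phi> \<and> ls_E' \<Psi> = ls_E' \<Phi>"
      using sys' sys\<Psi> by simp
  qed
  then have "(THE \<Psi>. ?P \<Psi>) = \<Phi>"
    using P by (intro the_equality)
  then show ?thesis
    by (simp add: designated_system_def)
qed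

text \<open>The idempotents of \<open>A\<close> are reversed if necessary, so that the row sum
  becomes their first eigenvalue. The dual ones are the matrix units in natural order, starting with
  the eigenvalue \<open>A' $$ (0, 0)\<close>.\<close>

lemma pair_TD_D_imp_system_TD_D:
  fixes A A' :: "'k::field mat" and d :: nat
  defines "M \<equiv> Mat_algebra (d + 1)"
  assumes td: "pair_TD_D M d A A'"
  obtains \<Phi> where "associated_system M d A A' \<Phi>" "system_TD_D M d \<Phi>"
proof -
  obtain \<theta> where "pair_eigenvalue_seq M d A A' \<theta>" and tri: "tridiagonal_mat A"
    and diag: "diagonal_mat A'" and row: "constant_row_sum A (\<theta> ! 0) \<or> constant_row_sum A (\<theta> ! d)"
    using td by (auto simp: pair_TD_D_def)
  then obtain E E' where full: "full_matrix_algebra M (d + 1)"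
    and mf: "multiplicity_free M d A" "multiplicity_free M d A'"
    and E: "idempotent_sequence M d A A' E" "primitive_idempotents_for M d A \<theta> E"
    and E': "idempotent_sequence M d A' A E'"
    by (auto simp: pair_eigenvalue_seq_def associated_system_def leonard_system_def system_eigenvalue_seq_def)
  have A: "A \<in> carrier_mat (d + 1) (d + 1)" "A' \<in> carrier_mat (d + 1) (d + 1)"
    using mf by (auto simp: multiplicity_free_def M_def module_mat_simps)
  obtain \<eta> F where F: "idempotent_sequence M d A A' F" "primitive_idempotents_for M d A \<eta> F"
    "constant_row_sum A (\<eta> ! 0)"
  proof (cases "constant_row_sum A (\<theta> ! 0)")
    case True
    then show thesis using that E by blast
  next
    case False
    moreover have "rev \<theta> ! 0 = \<theta> ! d"
      using E(2) by (simp add: primitive_idempotents_for_def rev_nth)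
    ultimately show thesis
      using that[of "rev E" "rev \<theta>"] row E idempotent_sequence_rev[OF A(1), of A' E]
        primitive_idempotents_for_rev[OF A(1), of \<theta> E] unfolding M_def by metis
  qed
  \<comment> \<open>The order of \<open>E'\<close> need not match the diagonal of \<open>A'\<close>,
    so \<open>E'\<close> is replaced; it only certifies that \<open>?U\<close> is a dual idempotent
    sequence.\<close>
  let ?U = "map (matrix_unit (d + 1)) [0..<d + 1]"
  have U: "idempotent_sequence M d A' A ?U" "primitive_idempotents_for M d A' (diag_mat A') ?U"
    using idempotent_sequence_matrix_units[OF A(1) tri _ diag, of E'] mf E'
      primitive_idempotents_for_diagonal[OF _ diag, of d] unfolding M_def by auto
  have "leonard_system M d (LSys A A' F ?U)"
    unfolding leonard_system_def using full mf F U by simp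
  moreover have "diag_mat A' ! 0 = A' $$ (0, 0)"
    using A(2) by (simp add: diag_mat_def del: upt_Suc)
  ultimately have "system_TD_D M d (LSys A A' F ?U)"
    using F U tri diag unfolding system_TD_D_def system_eigenvalue_seq_def system_dual_eigenvalue_seq_def
    by (intro conjI exI[of _ \<eta>] exI[of _ "diag_mat A'"]) (simp_all add: M_def)
  then show thesis
    by (intro that[of "LSys A A' F ?U"]) (auto simp: associated_system_def system_TD_D_def)
qed

theorem lemma22p4:
  fixes M :: "('k::field, 'k mat) module" and d :: nat and A A' :: "'k mat"
  assumes "leonard_pair M d A A'"
  shows "(pair_TD_D M d A A' \<longleftrightarrow> (\<exists>\<Phi>. associated_system M d A A' \<Phi> \<and> system_TD_D M d \<Phi>)) \<and>
    (\<forall>\<Phi>. associated_system M d A A' \<Phi> \<and> system_TD_D M d \<Phi> \<longrightarrow> \<Phi> = designated_system M d A A')"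
proof (intro conjI iffI allI impI)
  assume td: "pair_TD_D M d A A'"
  \<comment> \<open>The ambient algebra is arbitrary in the theorem; the canonical form forces it to
    be the matrix algebra of the preceding lemmas.\<close>
  then have "M = Mat_algebra (d + 1)"
    by (auto simp: pair_TD_D_def)
  then show "\<exists>\<Phi>. associated_system M d A A' \<Phi> \<and> system_TD_D M d \<Phi>"
    using td pair_TD_D_imp_system_TD_D by metis
next
  assume "\<exists>\<Phi>. associated_system M d A A' \<Phi> \<and> system_TD_D M d \<Phi>"
  then obtain \<Phi> where \<Phi>: "associated_system M d A A' \<Phi>" "system_TD_D M d \<Phi>"
    by blast
  \<comment> \<open>An eigenvalue sequence of \<Phi> is one of the pair, and the row sum is its
    first entry.\<close>
  then show "pair_TD_D M d A A'"
    using assms unfolding pair_TD_D_def pair_eigenvalue_seq_def system_TD_D_def associated_system_def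
    by metis
next
  fix \<Phi>
  assume \<Phi>: "associated_system M d A A' \<Phi> \<and> system_TD_D M d \<Phi>"
  then have "M = Mat_algebra (d + 1)"
    by (auto simp: system_TD_D_def)
  then show "\<Phi> = designated_system M d A A'"
    using \<Phi> system_TD_D_eq_designated_system by metis
qed

end
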